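(* Let $\Theta=(\alpha,\beta,\gamma)\in S_n\times S_n\times S_n$ and let $p\le n$ be a prime with $\mathbf{l}^\alpha_p\cdot\mathbf{l}^\beta_p>0$. Then: (a) if $\mathbf{l}^\gamma_1<p\cdot\max\{\mathbf{l}^\alpha_p,\mathbf{l}^\beta_p\}$ and $\mathbf{l}^\gamma_p=0$, then $\Delta(\Theta)=0$; (b) if $\mathbf{l}^\gamma_1=0$ and $\mathbf{l}^\gamma_p<\max\{\mathbf{l}^\alpha_p,\mathbf{l}^\beta_p\}$, then $\Delta(\Theta)=0$; (c) if $p=2$, $\mathbf{l}^\gamma_1=0$ and $\mathbf{l}^\gamma_2=1$, then $\Delta(\Theta)=0$.
   Context: Let $N=\{0,1,\dots,n-1\}$ and $S_n$ the symmetric group on $N$. A Latin square of order $n$ is an $n\times n$ array $L=(l_{i,j})$ with entries in $N$ in which each symbol occurs exactly once in each row and column. For $\Theta=(\alpha,\beta,\gamma)\in S_n^3$, $L^\Theta$ is the array with $(i,j)$ entry $\gamma^{-1}(l_{\alpha(i),\beta(j)})$; $\Theta$ is an autotopism of $L$ if $L^\Theta=L$. $\Delta(\Theta)$ is the number of Latin squares of order $n$ having $\Theta$ as an autotopism. For $\delta\in S_n$, $\mathbf{l}^\delta_r$ is the number of cycles of length $r$ in its disjoint cycle decomposition (fixed points are cycles of length 1). *)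

theory Defs
  imports
    "HOL-Combinatorics.Orbits"
    "HOL-Computational_Algebra.Primes"
begin

text \<open>
  Arrays over \<open>{..<n}\<close> are extensional functions (they are \<open>undefined\<close> outside the index set), so
  that equality of functions is equality of arrays and the set of all arrays is finite.
\<close>

definition latin_square :: "nat \<Rightarrow> (nat \<times> nat \<Rightarrow> nat) \<Rightarrow> bool" where
  "latin_square n L \<longleftrightarrow>
     L \<in> {..<n} \<times> {..<n} \<rightarrow>\<^sub>E {..<n} \<and>
     (\<forall>i\<in>{..<n}. \<forall>k\<in>{..<n}. \<exists>!j. j \<in> {..<n} \<and> L (i, j) = k) \<and>
     (\<forall>j\<in>{..<n}. \<forall>k\<in>{..<n}. \<exists>!i. i \<in> {..<n} \<and> L (i, j) = k)"

type_synonym perm_triple = "(nat \<Rightarrow> nat) \<times> (nat \<Rightarrow> nat) \<times> (nat \<Rightarrow> nat)"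

fun isotope :: "nat \<Rightarrow> perm_triple \<Rightarrow> (nat \<times> nat \<Rightarrow> nat) \<Rightarrow> nat \<times> nat \<Rightarrow> nat" where
  "isotope n (\<alpha>, \<beta>, \<gamma>) L =
     restrict (\<lambda>(i, j). inv \<gamma> (L (\<alpha> i, \<beta> j))) ({..<n} \<times> {..<n})"

definition autotopism :: "nat \<Rightarrow> perm_triple \<Rightarrow> (nat \<times> nat \<Rightarrow> nat) \<Rightarrow> bool" where
  "autotopism n \<Theta> L \<longleftrightarrow> isotope n \<Theta> L = L"

definition num_latin_squares :: "nat \<Rightarrow> perm_triple \<Rightarrow> nat" where
  "num_latin_squares n \<Theta> = card {L. latin_square n L \<and> autotopism n \<Theta> L}"

text \<open>
  The cycles of a permutation of \<open>{..<n}\<close> are identified with their supports, the orbits of its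
  elements; a fixed point gives a singleton orbit.
\<close>

definition cycle_count :: "nat \<Rightarrow> (nat \<Rightarrow> nat) \<Rightarrow> nat \<Rightarrow> nat" where
  "cycle_count n \<delta> r = card {C \<in> orbit \<delta> ` {..<n}. card C = r}"

text \<open>\<^const>\<open>num_latin_squares\<close> is the cardinality of a finite set, so its vanishing means emptiness.\<close>

lemma finite_latin_squares: "finite {L. latin_square n L \<and> P L}"
  by (rule finite_subset[of _ "{..<n} \<times> {..<n} \<rightarrow>\<^sub>E {..<n}"])
    (auto simp: latin_square_def intro!: finite_PiE)

lemma num_latin_squares_eq_0_iff:
  "num_latin_squares n \<Theta> = 0 \<longleftrightarrow> (\<nexists>L. latin_square n L \<and> autotopism n \<Theta> L)"
  by (simp add: num_latin_squares_def finite_latin_squares)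

end

theory Submission
  imports Defs "HOL-Combinatorics.Cycles"
begin

text \<open>
  If \<open>\<alpha>\<^sup>p\<close> fixes row \<open>i\<close> and \<open>\<beta>\<^sup>p\<close> fixes column \<open>j\<close>, then \<open>\<gamma>\<^sup>p\<close> fixes the symbol in cell
  \<open>(i, j)\<close>. Running through one fixed column (or row), the symbols are distinct, so the number of
  fixed points of \<open>\<gamma>\<^sup>p\<close>, which is \<open>l\<^sub>1 + p l\<^sub>p\<close> for \<open>p\<close> prime, is at least that of \<open>\<alpha>\<^sup>p\<close> (or \<open>\<beta>\<^sup>p\<close>).
  This gives (a) and (b). In (c), for \<open>i\<close> and \<open>j\<close> on 2-cycles, the cells
  \<open>(i, j)\<close> and \<open>(\<alpha> i, \<beta> j)\<close> hold different symbols, swapped by \<open>\<gamma>\<close>; the cell \<open>(i, \<beta> j)\<close> shares a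
  line with each of them, so it needs a third symbol fixed by \<open>\<gamma>\<^sup>2\<close>, but there are only two.
\<close>

text \<open>The list \<open>support f x\<close> runs through the orbit once, without repetition, up
  to the first return to \<open>x\<close>. This links the orbits counted by
  \<open>cycle_count\<close> to the divisibility facts about \<open>least_power\<close>.\<close>

lemma card_orbit_eq_least_power:
  assumes "permutation f"
  shows "card (orbit f x) = least_power f x"
proof -
  have "orbit f x = set (support f x)"
    using least_power_of_permutation[OF assms] orbit_altdef_bounded[of "least_power f x" f x]
    by auto
  moreover have "distinct (support f x)"
    by (rule cycle_of_permutation[OF assms])
  ultimately show ?thesis
    by (metis distinct_card length_map length_upt minus_nat.diff_0)
qed

lemma card_orbit_dvd_iff:
  assumes "permutation f"
  shows "card (orbit f x) dvd m \<longleftrightarrow> (f ^^ m) x = x"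
  by (simp add: card_orbit_eq_least_power least_power_dvd assms)

lemma card_points_in_cycles:
  assumes "\<delta> permutes {..<n}"
  shows "card {x \<in> {..<n}. card (orbit \<delta> x) = r} = r * cycle_count n \<delta> r"
proof -
  have cyc: "cyclic_on \<delta> (orbit \<delta> x)" for x
    using assms by (rule cyclic_on_orbit) simp
  have self: "x \<in> orbit \<delta> x" for x
    using assms by (meson finite_lessThan permutation_permutes permutation_self_in_orbit)
  let ?C = "{C \<in> orbit \<delta> ` {..<n}. card C = r}"
  \<comment> \<open>Any member of an orbit generates that same orbit, so orbit size is constant
    along a cycle.\<close>
  have union: "\<Union>?C = {x \<in> {..<n}. card (orbit \<delta> x) = r}"
    using permutes_orbit_subset[OF assms] self orbit_cyclic_eq3[OF cyc] by fastforce
  have "r * card ?C = card (\<Union>?C)"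
  proof (rule card_partition)
    show "finite (\<Union>?C)"
      unfolding union by simp
    show "c \<inter> d = {}" if "c \<in> ?C" "d \<in> ?C" "c \<noteq> d" for c d
      using that orbit_cyclic_eq3[OF cyc] by blast
  qed auto
  then show ?thesis
    by (simp add: union cycle_count_def)
qed

text \<open>A point is fixed by \<delta>^p exactly when its cycle length divides the prime p, hence
  is 1 or p. These two cases are disjoint.\<close>

lemma card_fixpoints_funpow_prime:
  assumes "\<delta> permutes {..<n}" and "prime p"
  shows "card {x \<in> {..<n}. (\<delta> ^^ p) x = x} = cycle_count n \<delta> 1 + p * cycle_count n \<delta> p"
proof -
  have perm: "permutation \<delta>"
    using assms(1) by (auto simp: permutation_permutes)
  have "{x \<in> {..<n}. (\<delta> ^^ p) x = x} =
      {x \<in> {..<n}. card (orbit \<delta> x) = 1} \<union> {x \<in> {..<n}. card (orbit \<delta> x) = p}"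
    using prime_nat_iff[of p] assms(2) by (auto simp flip: card_orbit_dvd_iff[OF perm])
  moreover have "{x \<in> {..<n}. card (orbit \<delta> x) = 1} \<inter> {x \<in> {..<n}. card (orbit \<delta> x) = p} = {}"
    using prime_gt_1_nat[OF assms(2)] by auto
  ultimately show ?thesis
    using card_points_in_cycles[OF assms(1), of 1] card_points_in_cycles[OF assms(1), of p]
    by (simp add: card_Un_disjoint)
qed

lemma cycle_count_pos_imp_point:
  assumes "0 < cycle_count n \<delta> r"
  obtains x where "x < n" and "card (orbit \<delta> x) = r"
proof -
  have "{C \<in> orbit \<delta> ` {..<n}. card C = r} \<noteq> {}"
    using assms unfolding cycle_count_def by (metis card.empty less_irrefl)
  then show thesis
    using that by auto
qed

context
  fixes n :: nat and L :: "nat \<times> nat \<Rightarrow> nat"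
  assumes latin: "latin_square n L"
begin

lemma latin_square_entry: "i < n \<Longrightarrow> j < n \<Longrightarrow> L (i, j) < n"
  using latin by (auto simp: latin_square_def PiE_iff)

lemma latin_square_row_cancel:
  "\<lbrakk>i < n; j < n; j' < n; L (i, j) = L (i, j')\<rbrakk> \<Longrightarrow> j = j'"
  \<comment> \<open>Uniqueness in the definition covers only symbols below \<open>n\<close>, so the
    repeated entry must be known to be in range.\<close>
  using latin latin_square_entry[of i j] unfolding latin_square_def
  by (metis lessThan_iff)

lemma latin_square_col_cancel:
  "\<lbrakk>j < n; i < n; i' < n; L (i, j) = L (i', j)\<rbrakk> \<Longrightarrow> i = i'"
  using latin latin_square_entry[of i j] unfolding latin_square_def
  by (metis lessThan_iff)

context
  fixes \<alpha> \<beta> \<gamma> :: "nat \<Rightarrow> nat"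
  assumes perms: "\<alpha> permutes {..<n}" "\<beta> permutes {..<n}" "\<gamma> permutes {..<n}"
    and auto: "autotopism n (\<alpha>, \<beta>, \<gamma>) L"
begin

lemma autotopism_entry:
  assumes "i < n" and "j < n"
  shows "L (\<alpha> i, \<beta> j) = \<gamma> (L (i, j))"
proof -
  have "inv \<gamma> (L (\<alpha> i, \<beta> j)) = L (i, j)"
    using fun_cong[OF auto[unfolded autotopism_def], of "(i, j)"] assms by simp
  then show ?thesis
    using permutes_inverses(1)[OF perms(3)] by metis
qed

lemma autotopism_entry_funpow:
  assumes "i < n" and "j < n"
  shows "L ((\<alpha> ^^ m) i, (\<beta> ^^ m) j) = (\<gamma> ^^ m) (L (i, j))"
proof (induction m)
  case (Suc m)
  have "(\<alpha> ^^ m) i < n" "(\<beta> ^^ m) j < n"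
    using permutes_in_image[OF permutes_funpow[OF perms(1)]]
      permutes_in_image[OF permutes_funpow[OF perms(2)]] assms by auto
  then show ?case
    by (simp add: autotopism_entry Suc)
qed simp

lemma autotopism_fixpoints_row_le:
  assumes "j < n" and "(\<beta> ^^ m) j = j"
  shows "card {i \<in> {..<n}. (\<alpha> ^^ m) i = i} \<le> card {k \<in> {..<n}. (\<gamma> ^^ m) k = k}"
proof (rule card_inj_on_le)
  show "inj_on (\<lambda>i. L (i, j)) {i \<in> {..<n}. (\<alpha> ^^ m) i = i}"
    using latin_square_col_cancel[OF assms(1)] by (auto intro: inj_onI)
  show "(\<lambda>i. L (i, j)) ` {i \<in> {..<n}. (\<alpha> ^^ m) i = i} \<subseteq> {k \<in> {..<n}. (\<gamma> ^^ m) k = k}"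
    using autotopism_entry_funpow[of _ j m] latin_square_entry assms by fastforce
qed simp

lemma autotopism_fixpoints_col_le:
  assumes "i < n" and "(\<alpha> ^^ m) i = i"
  shows "card {j \<in> {..<n}. (\<beta> ^^ m) j = j} \<le> card {k \<in> {..<n}. (\<gamma> ^^ m) k = k}"
proof (rule card_inj_on_le)
  show "inj_on (\<lambda>j. L (i, j)) {j \<in> {..<n}. (\<beta> ^^ m) j = j}"
    using latin_square_row_cancel[OF assms(1)] by (auto intro: inj_onI)
  show "(\<lambda>j. L (i, j)) ` {j \<in> {..<n}. (\<beta> ^^ m) j = j} \<subseteq> {k \<in> {..<n}. (\<gamma> ^^ m) k = k}"
    using autotopism_entry_funpow[of i _ m] latin_square_entry assms by fastforce
qed simp

text \<open>This one inequality serves both (a) and (b). A p-cycle of \<beta> supplies the fixed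
  column that bounds \<alpha>, and a p-cycle of \<alpha> supplies the fixed row that bounds
  \<beta>.\<close>

lemma autotopism_prime_cycle_bound:
  assumes "prime p" and "0 < cycle_count n \<alpha> p" and "0 < cycle_count n \<beta> p"
  shows "p * max (cycle_count n \<alpha> p) (cycle_count n \<beta> p)
    \<le> cycle_count n \<gamma> 1 + p * cycle_count n \<gamma> p"
proof -
  have perm: "permutation \<alpha>" "permutation \<beta>"
    using perms by (auto simp: permutation_permutes)
  obtain i where i: "i < n" "card (orbit \<alpha> i) = p"
    using assms(2) by (rule cycle_count_pos_imp_point)
  obtain j where j: "j < n" "card (orbit \<beta> j) = p"
    using assms(3) by (rule cycle_count_pos_imp_point)
  have "(\<alpha> ^^ p) i = i" "(\<beta> ^^ p) j = j"
    using card_orbit_dvd_iff[OF perm(1), of i p] card_orbit_dvd_iff[OF perm(2), of j p] i j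
    by simp_all
  from autotopism_fixpoints_row_le[OF j(1) this(2)] autotopism_fixpoints_col_le[OF i(1) this(1)]
  show ?thesis
    unfolding card_fixpoints_funpow_prime[OF perms(1) assms(1)]
      card_fixpoints_funpow_prime[OF perms(2) assms(1)]
      card_fixpoints_funpow_prime[OF perms(3) assms(1)]
    \<comment> \<open>The 1-cycles of \<alpha> and \<beta>, which only enlarge the smaller sides,
      are dropped here.\<close>
    by (auto simp: max_def)
qed

lemma autotopism_two_cycles:
  assumes "0 < cycle_count n \<alpha> 2" and "0 < cycle_count n \<beta> 2" and "cycle_count n \<gamma> 1 = 0"
  shows "cycle_count n \<gamma> 2 \<noteq> 1"
proof
  assume "cycle_count n \<gamma> 2 = 1"
  let ?K = "{k \<in> {..<n}. (\<gamma> ^^ 2) k = k}"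
  have card_K: "card ?K = 2"
    using card_fixpoints_funpow_prime[OF perms(3) two_is_prime_nat] assms(3)
      \<open>cycle_count n \<gamma> 2 = 1\<close> by simp
  have perm: "permutation \<alpha>" "permutation \<beta>"
    using perms by (auto simp: permutation_permutes)
  obtain i where i: "i < n" "card (orbit \<alpha> i) = 2"
    using assms(1) by (rule cycle_count_pos_imp_point)
  obtain j where j: "j < n" "card (orbit \<beta> j) = 2"
    using assms(2) by (rule cycle_count_pos_imp_point)
  have fix2: "(\<alpha> ^^ 2) i = i" "(\<beta> ^^ 2) j = j"
    using card_orbit_dvd_iff[OF perm(1), of i 2] card_orbit_dvd_iff[OF perm(2), of j 2] i j
    by simp_all
  then have fix2': "(\<beta> ^^ 2) (\<beta> j) = \<beta> j"
    by (simp add: numeral_2_eq_2)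
  have moved: "\<alpha> i \<noteq> i" "\<beta> j \<noteq> j"
    using orbit_eq_singleton_iff[of \<alpha> i] orbit_eq_singleton_iff[of \<beta> j] i j by auto
  have in_range: "\<alpha> i < n" "\<beta> j < n"
    using permutes_in_image[OF perms(1), of i] permutes_in_image[OF perms(2), of j] i j by auto
  \<comment> \<open>The set of points with orbit size 1 has cardinality 0 and is finite, hence
    empty.\<close>
  have no_fix: "\<gamma> k \<noteq> k" if "k < n" for k
    using card_points_in_cycles[OF perms(3), of 1] assms(3) orbit_eq_singleton_iff[of \<gamma> k] that
    by auto
  let ?x = "L (i, j)" and ?y = "L (i, \<beta> j)" and ?z = "L (\<alpha> i, \<beta> j)"
  have z: "?z = \<gamma> ?x"
    using autotopism_entry i j by simp
  have "?x \<in> ?K" "?y \<in> ?K"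
    using autotopism_entry_funpow[of i j 2] autotopism_entry_funpow[of i "\<beta> j" 2]
      latin_square_entry i j in_range fix2 fix2' by simp_all
  \<comment> \<open>Since \<open>?z\<close> is \<gamma> applied to \<open>?x\<close>, and \<gamma>
    commutes with its square, it is fixed by \<gamma>^2 too.\<close>
  moreover from this have "?z \<in> ?K"
    using latin_square_entry[OF in_range] z by (simp add: numeral_2_eq_2)
  \<comment> \<open>The first pair shares row \<open>i\<close>, the second shares column
    \<open>\<beta> j\<close>, and the third differs because \<gamma> moves every symbol.\<close>
  moreover have "?x \<noteq> ?y" "?y \<noteq> ?z" "?x \<noteq> ?z"
    using latin_square_row_cancel[of i j "\<beta> j"] latin_square_col_cancel[of "\<beta> j" i "\<alpha> i"]
      no_fix[of ?x] latin_square_entry[of i j] i j in_range moved z by auto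
  ultimately have "card {?x, ?y, ?z} = 3" "{?x, ?y, ?z} \<subseteq> ?K"
    by auto
  then have "3 \<le> card ?K"
    using card_mono[of ?K "{?x, ?y, ?z}"] by simp
  then show False
    using card_K by simp
qed

end

end

theorem theorem5:
  fixes n p :: nat and \<alpha> \<beta> \<gamma> :: "nat \<Rightarrow> nat"
  assumes "\<alpha> permutes {..<n}" and "\<beta> permutes {..<n}" and "\<gamma> permutes {..<n}"
    and "prime p" and "p \<le> n"
    and "cycle_count n \<alpha> p * cycle_count n \<beta> p > 0"
  shows "(cycle_count n \<gamma> 1 < p * max (cycle_count n \<alpha> p) (cycle_count n \<beta> p) \<and>
            cycle_count n \<gamma> p = 0
          \<longrightarrow> num_latin_squares n (\<alpha>, \<beta>, \<gamma>) = 0) \<and>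
         (cycle_count n \<gamma> 1 = 0 \<and>
            cycle_count n \<gamma> p < max (cycle_count n \<alpha> p) (cycle_count n \<beta> p)
          \<longrightarrow> num_latin_squares n (\<alpha>, \<beta>, \<gamma>) = 0) \<and>
         (p = 2 \<and> cycle_count n \<gamma> 1 = 0 \<and> cycle_count n \<gamma> 2 = 1
          \<longrightarrow> num_latin_squares n (\<alpha>, \<beta>, \<gamma>) = 0)"
proof -
  have pos: "0 < cycle_count n \<alpha> p" "0 < cycle_count n \<beta> p"
    using assms(6) by auto
  have "p * max (cycle_count n \<alpha> p) (cycle_count n \<beta> p)
      \<le> cycle_count n \<gamma> 1 + p * cycle_count n \<gamma> p"
    and "p = 2 \<Longrightarrow> cycle_count n \<gamma> 1 = 0 \<Longrightarrow> cycle_count n \<gamma> 2 \<noteq> 1"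
    if "num_latin_squares n (\<alpha>, \<beta>, \<gamma>) \<noteq> 0"
  proof -
    obtain L where L: "latin_square n L" "autotopism n (\<alpha>, \<beta>, \<gamma>) L"
      using \<open>num_latin_squares n (\<alpha>, \<beta>, \<gamma>) \<noteq> 0\<close> by (auto simp: num_latin_squares_eq_0_iff)
    show "p * max (cycle_count n \<alpha> p) (cycle_count n \<beta> p)
        \<le> cycle_count n \<gamma> 1 + p * cycle_count n \<gamma> p"
      using autotopism_prime_cycle_bound[OF L(1) assms(1-3) L(2) assms(4) pos] .
    show "p = 2 \<Longrightarrow> cycle_count n \<gamma> 1 = 0 \<Longrightarrow> cycle_count n \<gamma> 2 \<noteq> 1"
      using autotopism_two_cycles[OF L(1) assms(1-3) L(2)] pos by simp
  qed
  moreover have "0 < p"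
    using assms(4) by (rule prime_gt_0_nat)
  ultimately show ?thesis
    \<comment> \<open>Each part is the contrapositive: in (a) the term with the p-cycles of \<gamma>
      vanishes, and in (b) the remaining inequality is cancelled by p > 0.\<close>
    by (metis add_0 add.right_neutral linorder_not_less mult_0_right mult_le_cancel1)
qed

end
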